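(* Let $1\le p\le\infty$, let $\{X_t\}_{t\in(0,T)}$ be a monotone family of Banach spaces built from a vector space $V$ with semi-norms $\|\cdot\|_t$, and let $u\in L^0((0,T);\{X_t\})$ be a measurable section. Assume that (A) for any $v\in V$ the function $\psi_v(t)=\|u(t)-v\|_t$ belongs to $W^{1,p}((0,T))$; (B) the family of derivatives $\{\psi_v'\}_{v\in V}$ has a majorant $\psi'\in L^p((0,T))$, i.e. for every $v\in V$ one has $|\psi_v'(t)|\le\psi'(t)$ for almost all $t\in(0,T)$. Then $u\in W^{1,p}((0,T);\{X_t\})$.
   Context: Monotone Banach family: let $0<T\le\infty$ and let $(0,T)$ carry Lebesgue measure. Let $V$ be a real vector space and $\{\|\cdot\|_t\}_{t\in(0,T)}$ a family of semi-norms on $V$ such that for each $v\in V$ the function $t\mapsto\|v\|_t$ is non-increasing. $X_t$ denotes the Banach space obtained by completing $V/\ker(\|\cdot\|_t)$ with respect to $\|\cdot\|_t$; $\{X_t\}_{t\in(0,T)}$ is called a monotone family of Banach spaces. An element $v\in V$ is viewed as an element of each $X_t$. For $s\le t$ the operator $P(s,t):X_s\to X_t$ is defined as follows: if $x\in X_s$ is the limit in $X_s$ of a sequence $\{v_k\}\subset V$ that is Cauchy for $\|\cdot\|_s$, then $\{v_k\}$ is Cauchy for $\|\cdot\|_t$ and $P(s,t)x$ is its limit in $X_t$. Sections: a section is a map $f:(0,T)\to\bigcup_t X_t$ with $f(t)\in X_t$ for each $t$. A simple section is one of the form $f(t)=\sum_{k=1}^n\chi_{A_k}(t)v_k$ with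 $v_k\in V$ and $A_k\subset(0,T)$ measurable. A section $f$ is measurable if there are simple sections $f_k$ with $f_k(t)\to f(t)$ in $X_t$ for almost all $t$. $L^0((0,T);\{X_t\})$ is the space of a.e.-equivalence classes of measurable sections. For $1\le p\le\infty$, $L^p((0,T);\{X_t\})$ is the space of measurable sections $f$ such that $t\mapsto\|f(t)\|_t$ belongs to $L^p((0,T))$. Sobolev space: a measurable section $u$ is in $W^{1,p}((0,T);\{X_t\})$ if $u\in L^p((0,T);\{X_t\})$ and there exists $g\in L^p((0,T))$ such that $$\|u(t)-P(s,t)u(s)\|_t\le\int_s^t g(\tau)\,d\tau\quad\text{for almost all } s,t\in(0,T),\ s\le t.$$ $W^{1,p}((0,T))$ is the usual Sobolev space of real-valued functions. *)

theory Defs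
  imports "HOL-Analysis.Analysis"
begin

section \<open>The Banach completion of a semi-normed space\<close>

definition seminorm :: "('v::real_vector \<Rightarrow> real) \<Rightarrow> bool" where
  "seminorm p \<longleftrightarrow>
     (\<forall>x y. p (x + y) \<le> p x + p y) \<and> (\<forall>c x. p (c *\<^sub>R x) = \<bar>c\<bar> * p x)"

text \<open>
  The completion of \<open>V / ker p\<close> is the usual one: \<open>p\<close>-Cauchy sequences modulo sequences of
  vanishing distance. Two sequences in \<open>V\<close> that agree modulo \<open>ker p\<close> are equivalent, so passing
  to the quotient \<open>V / ker p\<close> first would give the same classes; we work with sequences in \<open>V\<close>.
\<close>

definition cauchy_seqs :: "('v::real_vector \<Rightarrow> real) \<Rightarrow> (nat \<Rightarrow> 'v) set" where
  "cauchy_seqs p = {a. \<forall>e>0. \<exists>M. \<forall>m\<ge>M. \<forall>n\<ge>M. p (a m - a n) < e}"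

definition seq_equiv :: "('v::real_vector \<Rightarrow> real) \<Rightarrow> ((nat \<Rightarrow> 'v) \<times> (nat \<Rightarrow> 'v)) set" where
  "seq_equiv p = {(a, b). a \<in> cauchy_seqs p \<and> b \<in> cauchy_seqs p \<and> (\<lambda>n. p (a n - b n)) \<longlonglongrightarrow> 0}"

definition ccompletion :: "('v::real_vector \<Rightarrow> real) \<Rightarrow> (nat \<Rightarrow> 'v) set set" where
  "ccompletion p = cauchy_seqs p // seq_equiv p"

definition cclass :: "('v::real_vector \<Rightarrow> real) \<Rightarrow> (nat \<Rightarrow> 'v) \<Rightarrow> (nat \<Rightarrow> 'v) set" where
  "cclass p a = seq_equiv p `` {a}"

definition cembed :: "('v::real_vector \<Rightarrow> real) \<Rightarrow> 'v \<Rightarrow> (nat \<Rightarrow> 'v) set" where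
  "cembed p v = cclass p (\<lambda>_. v)"

definition cdiff ::
  "('v::real_vector \<Rightarrow> real) \<Rightarrow> (nat \<Rightarrow> 'v) set \<Rightarrow> (nat \<Rightarrow> 'v) set \<Rightarrow> (nat \<Rightarrow> 'v) set" where
  "cdiff p x y = (\<Union>a\<in>x. \<Union>b\<in>y. cclass p (\<lambda>n. a n - b n))"

definition cnorm :: "('v::real_vector \<Rightarrow> real) \<Rightarrow> (nat \<Rightarrow> 'v) set \<Rightarrow> real" where
  "cnorm p x = (THE r. \<forall>a\<in>x. (\<lambda>n. p (a n)) \<longlonglongrightarrow> r)"

text \<open>
  The canonical operator between two completions, for semi-norms with \<open>q \<le> p\<close>. It is well defined
  by lemma \<open>ctransition_cclass\<close> below.
\<close>

definition ctransition ::
  "('v::real_vector \<Rightarrow> real) \<Rightarrow> ('v \<Rightarrow> real) \<Rightarrow> (nat \<Rightarrow> 'v) set \<Rightarrow> (nat \<Rightarrow> 'v) set" where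
  "ctransition p q x = (THE y. y \<in> ccompletion q \<and>
     (\<exists>v\<in>cauchy_seqs p. (\<lambda>k. cnorm p (cdiff p (cembed p (v k)) x)) \<longlonglongrightarrow> 0 \<and>
                        (\<lambda>k. cnorm q (cdiff q (cembed q (v k)) y)) \<longlonglongrightarrow> 0))"

subsection \<open>Well-definedness and completeness\<close>

lemma seminorm_triangle: "seminorm p \<Longrightarrow> p (x + y) \<le> p x + p y"
  by (simp add: seminorm_def)

lemma seminorm_minus: "seminorm p \<Longrightarrow> p (- x) = p x"
  unfolding seminorm_def by (metis abs_minus_cancel abs_one mult_1 scaleR_minus1_left)

lemma seminorm_zero: "seminorm p \<Longrightarrow> p 0 = 0"
  unfolding seminorm_def by (metis abs_zero mult_zero_left scaleR_zero_left)

lemma seminorm_nonneg: "seminorm p \<Longrightarrow> 0 \<le> p x"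
  using seminorm_triangle[of p x "- x"] by (simp add: seminorm_minus seminorm_zero)

lemma seminorm_commute: "seminorm p \<Longrightarrow> p (x - y) = p (y - x)"
  by (metis minus_diff_eq seminorm_minus)

lemma seminorm_triangle3: "seminorm p \<Longrightarrow> p (x - z) \<le> p (x - y) + p (y - z)"
  using seminorm_triangle[of p "x - y" "y - z"] by simp

lemma seminorm_abs_diff: "seminorm p \<Longrightarrow> \<bar>p x - p y\<bar> \<le> p (x - y)"
  using seminorm_triangle[of p "x - y" y] seminorm_triangle[of p "y - x" x]
    seminorm_commute[of p x y] by simp

lemma equiv_seq_equiv:
  assumes p: "seminorm p"
  shows "equiv (cauchy_seqs p) (seq_equiv p)"
proof (rule equivI)
  show "seq_equiv p \<subseteq> cauchy_seqs p \<times> cauchy_seqs p"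
    by (auto simp: seq_equiv_def)
  show "refl_on (cauchy_seqs p) (seq_equiv p)"
    by (auto simp: refl_on_def seq_equiv_def seminorm_zero[OF p])
  show "sym (seq_equiv p)"
    by (auto simp: sym_def seq_equiv_def seminorm_commute[OF p])
  show "trans (seq_equiv p)"
  proof (rule transI)
    fix a b c assume "(a, b) \<in> seq_equiv p" "(b, c) \<in> seq_equiv p"
    then have ac: "a \<in> cauchy_seqs p" "c \<in> cauchy_seqs p"
      and l: "(\<lambda>n. p (a n - b n)) \<longlonglongrightarrow> 0" "(\<lambda>n. p (b n - c n)) \<longlonglongrightarrow> 0"
      by (auto simp: seq_equiv_def)
    have "(\<lambda>n. p (a n - b n) + p (b n - c n)) \<longlonglongrightarrow> 0"
      using tendsto_add[OF l] by simp
    then have "(\<lambda>n. p (a n - c n)) \<longlonglongrightarrow> 0"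
      by (rule Lim_null_comparison[rotated])
         (simp add: seminorm_nonneg[OF p] seminorm_triangle3[OF p])
    with ac show "(a, c) \<in> seq_equiv p" by (simp add: seq_equiv_def)
  qed
qed

lemma cauchy_seqs_diff:
  assumes p: "seminorm p" and a: "a \<in> cauchy_seqs p" and b: "b \<in> cauchy_seqs p"
  shows "(\<lambda>n. a n - b n) \<in> cauchy_seqs p"
  unfolding cauchy_seqs_def
proof (safe)
  fix e :: real assume "e > 0"
  then have e2: "e / 2 > 0" by simp
  obtain M1 where M1: "\<And>m n. m \<ge> M1 \<Longrightarrow> n \<ge> M1 \<Longrightarrow> p (a m - a n) < e / 2"
    using a e2 unfolding cauchy_seqs_def by blast
  obtain M2 where M2: "\<And>m n. m \<ge> M2 \<Longrightarrow> n \<ge> M2 \<Longrightarrow> p (b m - b n) < e / 2"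
    using b e2 unfolding cauchy_seqs_def by blast
  have "p (a m - b m - (a n - b n)) < e" if "m \<ge> max M1 M2" "n \<ge> max M1 M2" for m n
  proof -
    have "p (a m - b m - (a n - b n)) = p ((a m - a n) + (b n - b m))"
      by (simp add: algebra_simps)
    also have "\<dots> \<le> p (a m - a n) + p (b n - b m)" by (rule seminorm_triangle[OF p])
    also have "\<dots> < e" using M1[of m n] M2[of n m] that by simp
    finally show ?thesis .
  qed
  then show "\<exists>M. \<forall>m\<ge>M. \<forall>n\<ge>M. p (a m - b m - (a n - b n)) < e" by blast
qed

lemma cauchy_seqs_const: "seminorm p \<Longrightarrow> (\<lambda>_. v) \<in> cauchy_seqs p"
  by (simp add: cauchy_seqs_def seminorm_zero)

lemma cclass_in_ccompletion: "a \<in> cauchy_seqs p \<Longrightarrow> cclass p a \<in> ccompletion p"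
  by (simp add: ccompletion_def cclass_def quotientI)

lemma cembed_in_ccompletion: "seminorm p \<Longrightarrow> cembed p v \<in> ccompletion p"
  by (simp add: cembed_def cclass_in_ccompletion cauchy_seqs_const)

lemma ccompletionE:
  assumes "x \<in> ccompletion p"
  obtains a where "a \<in> cauchy_seqs p" "x = cclass p a"
  using assms unfolding ccompletion_def cclass_def by (auto elim!: quotientE)

lemma cclass_eq_iff:
  assumes "seminorm p" "a \<in> cauchy_seqs p" "b \<in> cauchy_seqs p"
  shows "cclass p a = cclass p b \<longleftrightarrow> (\<lambda>n. p (a n - b n)) \<longlonglongrightarrow> 0"
  using eq_equiv_class_iff[OF equiv_seq_equiv[OF assms(1)] assms(2,3)] assms(2,3)
  unfolding cclass_def by (simp add: seq_equiv_def)

lemma cnorm_cclass: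
  assumes p: "seminorm p" and a: "a \<in> cauchy_seqs p"
  shows "(\<lambda>n. p (a n)) \<longlonglongrightarrow> cnorm p (cclass p a)"
proof -
  have "Cauchy (\<lambda>n. p (a n))"
  proof (rule metric_CauchyI)
    fix e :: real assume "e > 0"
    with a obtain M where "\<And>m n. m \<ge> M \<Longrightarrow> n \<ge> M \<Longrightarrow> p (a m - a n) < e"
      unfolding cauchy_seqs_def by blast
    then show "\<exists>M. \<forall>m\<ge>M. \<forall>n\<ge>M. dist (p (a m)) (p (a n)) < e"
      unfolding dist_real_def using seminorm_abs_diff[OF p] le_less_trans by blast
  qed
  then obtain r where r: "(\<lambda>n. p (a n)) \<longlonglongrightarrow> r"
    using Cauchy_convergent_iff convergent_def by blast
  have all: "(\<lambda>n. p (b n)) \<longlonglongrightarrow> r" if "b \<in> cclass p a" for b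
  proof -
    have "(\<lambda>n. p (a n - b n)) \<longlonglongrightarrow> 0"
      using that by (simp add: cclass_def seq_equiv_def)
    then have "(\<lambda>n. p (b n) - p (a n)) \<longlonglongrightarrow> 0"
      by (rule Lim_null_comparison[rotated])
         (use seminorm_abs_diff[OF p] seminorm_commute[OF p] in \<open>metis (no_types, lifting) eventuallyI real_norm_def\<close>)
    from tendsto_add[OF this r] show ?thesis by simp
  qed
  have mem: "a \<in> cclass p a"
    using equiv_class_self[OF equiv_seq_equiv[OF p] a] by (simp add: cclass_def)
  have "cnorm p (cclass p a) = r"
    unfolding cnorm_def using all mem by (intro the_equality) (auto intro: LIMSEQ_unique)
  with r show ?thesis by simp
qed

lemma cdiff_cclass:
  assumes p: "seminorm p" and a: "a \<in> cauchy_seqs p" and b: "b \<in> cauchy_seqs p"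
  shows "cdiff p (cclass p a) (cclass p b) = cclass p (\<lambda>n. a n - b n)"
proof -
  have eq: "cclass p (\<lambda>n. a' n - b' n) = cclass p (\<lambda>n. a n - b n)"
    if "a' \<in> cclass p a" "b' \<in> cclass p b" for a' b'
  proof -
    from that have c: "a' \<in> cauchy_seqs p" "b' \<in> cauchy_seqs p"
      and l: "(\<lambda>n. p (a n - a' n)) \<longlonglongrightarrow> 0" "(\<lambda>n. p (b n - b' n)) \<longlonglongrightarrow> 0"
      by (auto simp: cclass_def seq_equiv_def)
    have "(\<lambda>n. p (a n - a' n) + p (b n - b' n)) \<longlonglongrightarrow> 0"
      using tendsto_add[OF l] by simp
    then have "(\<lambda>n. p (a' n - b' n - (a n - b n))) \<longlonglongrightarrow> 0"
    proof (rule Lim_null_comparison[rotated], intro eventuallyI)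
      fix n
      have "p (a' n - b' n - (a n - b n)) = p ((a' n - a n) + (b n - b' n))"
        by (simp add: algebra_simps)
      also have "\<dots> \<le> p (a n - a' n) + p (b n - b' n)"
        using seminorm_triangle[OF p] seminorm_commute[OF p] by metis
      finally show "norm (p (a' n - b' n - (a n - b n))) \<le> p (a n - a' n) + p (b n - b' n)"
        by (simp add: seminorm_nonneg[OF p])
    qed
    then show ?thesis
      using cclass_eq_iff[OF p cauchy_seqs_diff[OF p c] cauchy_seqs_diff[OF p a b]] by simp
  qed
  have mem: "a \<in> cclass p a" "b \<in> cclass p b"
    using equiv_class_self[OF equiv_seq_equiv[OF p]] a b by (simp_all add: cclass_def)
  have "cdiff p (cclass p a) (cclass p b)
      = (\<Union>a'\<in>cclass p a. \<Union>b'\<in>cclass p b. cclass p (\<lambda>n. a n - b n))"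
    unfolding cdiff_def using eq by (intro SUP_cong refl) auto
  also have "\<dots> = cclass p (\<lambda>n. a n - b n)" using mem by auto
  finally show ?thesis .
qed

lemma cnorm_cembed: "seminorm p \<Longrightarrow> cnorm p (cembed p v) = p v"
  using LIMSEQ_unique[OF cnorm_cclass[OF _ cauchy_seqs_const] tendsto_const]
  unfolding cembed_def by blast

lemma cembed_tendsto_cclass:
  assumes p: "seminorm p" and a: "a \<in> cauchy_seqs p"
  shows "(\<lambda>k. cnorm p (cdiff p (cembed p (a k)) (cclass p a))) \<longlonglongrightarrow> 0"
proof (rule LIMSEQ_I)
  fix e :: real assume "e > 0"
  then have "e / 2 > 0" by simp
  with a obtain M where M: "\<And>m n. m \<ge> M \<Longrightarrow> n \<ge> M \<Longrightarrow> p (a m - a n) < e / 2"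
    unfolding cauchy_seqs_def by blast
  have "norm (cnorm p (cdiff p (cembed p (a k)) (cclass p a)) - 0) < e" if "k \<ge> M" for k
  proof -
    have l: "(\<lambda>n. p (a k - a n)) \<longlonglongrightarrow> cnorm p (cdiff p (cembed p (a k)) (cclass p a))"
      unfolding cembed_def cdiff_cclass[OF p cauchy_seqs_const[OF p] a]
      by (rule cnorm_cclass[OF p cauchy_seqs_diff[OF p cauchy_seqs_const[OF p] a]])
    have "cnorm p (cdiff p (cembed p (a k)) (cclass p a)) \<le> e / 2"
      by (rule LIMSEQ_le_const2[OF l]) (use M[OF that] in \<open>auto intro: less_imp_le\<close>)
    moreover have "0 \<le> cnorm p (cdiff p (cembed p (a k)) (cclass p a))"
      by (rule LIMSEQ_le_const[OF l]) (simp add: seminorm_nonneg[OF p])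
    ultimately show ?thesis using \<open>e > 0\<close> by simp
  qed
  then show "\<exists>M. \<forall>k\<ge>M. norm (cnorm p (cdiff p (cembed p (a k)) (cclass p a)) - 0) < e" by blast
qed

lemma cnorm_cdiff_triangle:
  assumes p: "seminorm p" and "x \<in> ccompletion p" "y \<in> ccompletion p" "z \<in> ccompletion p"
  shows "cnorm p (cdiff p x z) \<le> cnorm p (cdiff p x y) + cnorm p (cdiff p y z)"
proof -
  obtain a b c where abc: "a \<in> cauchy_seqs p" "x = cclass p a" "b \<in> cauchy_seqs p" "y = cclass p b"
    "c \<in> cauchy_seqs p" "z = cclass p c"
    using assms(2-4) by (meson ccompletionE)
  note l = cnorm_cclass[OF p cauchy_seqs_diff[OF p]]
  show ?thesis unfolding abc(2,4,6) cdiff_cclass[OF p abc(1,5)] cdiff_cclass[OF p abc(1,3)]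
      cdiff_cclass[OF p abc(3,5)]
    by (rule LIMSEQ_le[OF l[OF abc(1,5)] tendsto_add[OF l[OF abc(1,3)] l[OF abc(3,5)]]])
       (auto simp: seminorm_triangle3[OF p])
qed

lemma cnorm_cdiff_commute:
  assumes p: "seminorm p" and "x \<in> ccompletion p" "y \<in> ccompletion p"
  shows "cnorm p (cdiff p x y) = cnorm p (cdiff p y x)"
proof -
  obtain a b where ab: "a \<in> cauchy_seqs p" "x = cclass p a" "b \<in> cauchy_seqs p" "y = cclass p b"
    using assms(2,3) by (meson ccompletionE)
  have "(\<lambda>n. p (a n - b n)) = (\<lambda>n. p (b n - a n))"
    using seminorm_commute[OF p] by blast
  then show ?thesis unfolding ab(2,4) cdiff_cclass[OF p ab(1,3)] cdiff_cclass[OF p ab(3,1)]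
    using cnorm_cclass[OF p cauchy_seqs_diff[OF p ab(1,3)]]
      cnorm_cclass[OF p cauchy_seqs_diff[OF p ab(3,1)]] by (simp add: LIMSEQ_unique)
qed

lemma cnorm_cdiff_nonneg:
  assumes p: "seminorm p" and "x \<in> ccompletion p" "y \<in> ccompletion p"
  shows "0 \<le> cnorm p (cdiff p x y)"
proof -
  obtain a b where ab: "a \<in> cauchy_seqs p" "x = cclass p a" "b \<in> cauchy_seqs p" "y = cclass p b"
    using assms(2,3) by (meson ccompletionE)
  show ?thesis unfolding ab(2,4) cdiff_cclass[OF p ab(1,3)]
    by (rule LIMSEQ_le_const[OF cnorm_cclass[OF p cauchy_seqs_diff[OF p ab(1,3)]]])
       (simp add: seminorm_nonneg[OF p])
qed

lemma cnorm_cdiff_eq_0_iff: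
  assumes p: "seminorm p" and "x \<in> ccompletion p" "y \<in> ccompletion p"
  shows "cnorm p (cdiff p x y) = 0 \<longleftrightarrow> x = y"
proof -
  obtain a b where ab: "a \<in> cauchy_seqs p" "x = cclass p a" "b \<in> cauchy_seqs p" "y = cclass p b"
    using assms(2,3) by (meson ccompletionE)
  show ?thesis unfolding ab(2,4) cdiff_cclass[OF p ab(1,3)] cclass_eq_iff[OF p ab(1,3)]
    using cnorm_cclass[OF p cauchy_seqs_diff[OF p ab(1,3)]] by (auto dest: LIMSEQ_unique)
qed

lemma ccompletion_limit_unique:
  assumes p: "seminorm p" and x: "x \<in> ccompletion p" and y: "y \<in> ccompletion p"
    and w: "\<And>k. w k \<in> ccompletion p"
    and lx: "(\<lambda>k. cnorm p (cdiff p (w k) x)) \<longlonglongrightarrow> 0"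
    and ly: "(\<lambda>k. cnorm p (cdiff p (w k) y)) \<longlonglongrightarrow> 0"
  shows "x = y"
proof -
  have "cnorm p (cdiff p x y) \<le> cnorm p (cdiff p (w k) x) + cnorm p (cdiff p (w k) y)" for k
    using cnorm_cdiff_triangle[OF p x w[of k] y] cnorm_cdiff_commute[OF p x w[of k]] by simp
  then have "cnorm p (cdiff p x y) \<le> 0"
    using LIMSEQ_le_const[OF tendsto_add[OF lx ly]] by fastforce
  then show ?thesis
    using cnorm_cdiff_nonneg[OF p x y] cnorm_cdiff_eq_0_iff[OF p x y] by simp
qed

lemma cauchy_seqs_mono: "(\<And>v. q v \<le> p v) \<Longrightarrow> cauchy_seqs p \<subseteq> cauchy_seqs q"
  unfolding cauchy_seqs_def by (blast intro: le_less_trans)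

lemma ctransition_cclass:
  assumes p: "seminorm p" and q: "seminorm q" and le: "\<And>v. q v \<le> p v"
    and a: "a \<in> cauchy_seqs p"
  shows "ctransition p q (cclass p a) = cclass q a"
  unfolding ctransition_def
proof (rule the_equality)
  have aq: "a \<in> cauchy_seqs q" using cauchy_seqs_mono[of q p, OF le] a by blast
  show "cclass q a \<in> ccompletion q \<and> (\<exists>v\<in>cauchy_seqs p.
      (\<lambda>k. cnorm p (cdiff p (cembed p (v k)) (cclass p a))) \<longlonglongrightarrow> 0 \<and>
      (\<lambda>k. cnorm q (cdiff q (cembed q (v k)) (cclass q a))) \<longlonglongrightarrow> 0)"
    using cclass_in_ccompletion[OF aq] cembed_tendsto_cclass[OF p a] cembed_tendsto_cclass[OF q aq] a
    by blast
  fix y assume "y \<in> ccompletion q \<and> (\<exists>v\<in>cauchy_seqs p.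
      (\<lambda>k. cnorm p (cdiff p (cembed p (v k)) (cclass p a))) \<longlonglongrightarrow> 0 \<and>
      (\<lambda>k. cnorm q (cdiff q (cembed q (v k)) y)) \<longlonglongrightarrow> 0)"
  then obtain v where y: "y \<in> ccompletion q" and v: "v \<in> cauchy_seqs p"
    and l1: "(\<lambda>k. cnorm p (cdiff p (cembed p (v k)) (cclass p a))) \<longlonglongrightarrow> 0"
    and l2: "(\<lambda>k. cnorm q (cdiff q (cembed q (v k)) y)) \<longlonglongrightarrow> 0" by blast
  have vq: "v \<in> cauchy_seqs q" using cauchy_seqs_mono[of q p, OF le] v by blast
  have "cclass p v = cclass p a"
    using ccompletion_limit_unique[OF p cclass_in_ccompletion[OF v] cclass_in_ccompletion[OF a]
        cembed_in_ccompletion[OF p] cembed_tendsto_cclass[OF p v] l1] .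
  then have "(\<lambda>n. p (v n - a n)) \<longlonglongrightarrow> 0" using cclass_eq_iff[OF p v a] by simp
  then have "(\<lambda>n. q (v n - a n)) \<longlonglongrightarrow> 0"
    by (rule Lim_null_comparison[rotated]) (simp add: seminorm_nonneg[OF q] le)
  then have "cclass q v = cclass q a" using cclass_eq_iff[OF q vq aq] by simp
  moreover have "y = cclass q v"
    using ccompletion_limit_unique[OF q y cclass_in_ccompletion[OF vq] cembed_in_ccompletion[OF q] l2
        cembed_tendsto_cclass[OF q vq]] .
  ultimately show "y = cclass q a" by simp
qed

lemma ccompletion_complete:
  assumes p: "seminorm p" and x: "\<And>k. x k \<in> ccompletion p"
    and cau: "\<And>e. e > 0 \<Longrightarrow> \<exists>M. \<forall>m\<ge>M. \<forall>n\<ge>M. cnorm p (cdiff p (x m) (x n)) < e"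
  shows "\<exists>y\<in>ccompletion p. (\<lambda>k. cnorm p (cdiff p (x k) y)) \<longlonglongrightarrow> 0"
proof -
  have "\<exists>v. cnorm p (cdiff p (cembed p v) (x k)) < inverse (real (Suc k))" for k
  proof -
    obtain a where a: "a \<in> cauchy_seqs p" "x k = cclass p a" using x by (meson ccompletionE)
    have "\<forall>\<^sub>F n in sequentially. cnorm p (cdiff p (cembed p (a n)) (x k)) < inverse (real (Suc k))"
      using order_tendstoD(2)[OF cembed_tendsto_cclass[OF p a(1)], of "inverse (real (Suc k))"] a(2)
      by simp
    then show ?thesis using eventually_happens by force
  qed
  then obtain v where v: "\<And>k. cnorm p (cdiff p (cembed p (v k)) (x k)) < inverse (real (Suc k))"
    by metis
  note emb = cembed_in_ccompletion[OF p]
  have "v \<in> cauchy_seqs p"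
    unfolding cauchy_seqs_def
  proof safe
    fix e :: real assume "e > 0"
    then have e3: "e / 3 > 0" by simp
    obtain M1 where M1: "\<And>m n. m \<ge> M1 \<Longrightarrow> n \<ge> M1 \<Longrightarrow> cnorm p (cdiff p (x m) (x n)) < e / 3"
      using cau[OF e3] by blast
    obtain M2 where M2: "inverse (real (Suc M2)) < e / 3" using reals_Archimedean[OF e3] by blast
    have "p (v m - v n) < e" if mn: "m \<ge> max M1 M2" "n \<ge> max M1 M2" for m n
    proof -
      have small: "cnorm p (cdiff p (cembed p (v k)) (x k)) < e / 3" if "k \<ge> M2" for k
      proof -
        have "inverse (real (Suc k)) \<le> inverse (real (Suc M2))"
          using that by (intro le_imp_inverse_le) auto
        then show ?thesis using v[of k] M2 by linarith
      qed
      have "p (v m - v n) = cnorm p (cdiff p (cembed p (v m)) (cembed p (v n)))"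
        using cnorm_cembed[OF p, of "v m - v n"]
        unfolding cembed_def cdiff_cclass[OF p cauchy_seqs_const[OF p] cauchy_seqs_const[OF p]] by simp
      also have "\<dots> \<le> cnorm p (cdiff p (cembed p (v m)) (x m))
          + (cnorm p (cdiff p (x m) (x n)) + cnorm p (cdiff p (x n) (cembed p (v n))))"
        using cnorm_cdiff_triangle[OF p emb[of "v m"] x[of m] emb[of "v n"]]
          cnorm_cdiff_triangle[OF p x[of m] x[of n] emb[of "v n"]] by linarith
      also have "\<dots> < e"
        using small[of m] small[of n] M1[of m n] mn cnorm_cdiff_commute[OF p x[of n] emb[of "v n"]] by simp
      finally show ?thesis .
    qed
    then show "\<exists>M. \<forall>m\<ge>M. \<forall>n\<ge>M. p (v m - v n) < e" by blast
  qed
  note vC = this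
  have "(\<lambda>k. inverse (real (Suc k)) + cnorm p (cdiff p (cembed p (v k)) (cclass p v))) \<longlonglongrightarrow> 0"
    using tendsto_add[OF LIMSEQ_inverse_real_of_nat cembed_tendsto_cclass[OF p vC]] by simp
  then have "(\<lambda>k. cnorm p (cdiff p (x k) (cclass p v))) \<longlonglongrightarrow> 0"
  proof (rule Lim_null_comparison[rotated], intro eventuallyI)
    fix k
    show "norm (cnorm p (cdiff p (x k) (cclass p v)))
        \<le> inverse (real (Suc k)) + cnorm p (cdiff p (cembed p (v k)) (cclass p v))"
      using cnorm_cdiff_nonneg[OF p x[of k] cclass_in_ccompletion[OF vC]]
        cnorm_cdiff_triangle[OF p x[of k] emb[of "v k"] cclass_in_ccompletion[OF vC]]
        cnorm_cdiff_commute[OF p x[of k] emb[of "v k"]] v[of k] by simp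
  qed
  then show ?thesis using cclass_in_ccompletion[OF vC] by blast
qed

section \<open>Scalar Lebesgue and Sobolev spaces on an interval\<close>

definition time_interval :: "ereal \<Rightarrow> real set" where
  "time_interval T = {t. 0 < t \<and> ereal t < T}"

definition Lp :: "ereal \<Rightarrow> real set \<Rightarrow> (real \<Rightarrow> real) \<Rightarrow> bool" where
  "Lp p I f \<longleftrightarrow> f \<in> borel_measurable (lebesgue_on I) \<and>
     (if p = \<infinity> then \<exists>C. AE t in lebesgue_on I. \<bar>f t\<bar> \<le> C
      else integrable (lebesgue_on I) (\<lambda>t. \<bar>f t\<bar> powr real_of_ereal p))"

definition locally_integrable :: "real set \<Rightarrow> (real \<Rightarrow> real) \<Rightarrow> bool" where
  "locally_integrable I f \<longleftrightarrow> (\<forall>K. compact K \<longrightarrow> K \<subseteq> I \<longrightarrow> integrable (lebesgue_on K) f)"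

text \<open>Smooth functions on the line whose support is a compact subset of \<open>I\<close>.\<close>

definition test_function :: "real set \<Rightarrow> (real \<Rightarrow> real) \<Rightarrow> bool" where
  "test_function I \<phi> \<longleftrightarrow> (\<forall>n t. ((deriv ^^ n) \<phi>) differentiable (at t)) \<and>
     (\<exists>K. compact K \<and> K \<subseteq> I \<and> (\<forall>t. t \<notin> K \<longrightarrow> \<phi> t = 0))"

definition has_weak_derivative :: "real set \<Rightarrow> (real \<Rightarrow> real) \<Rightarrow> (real \<Rightarrow> real) \<Rightarrow> bool" where
  "has_weak_derivative I f g \<longleftrightarrow> locally_integrable I f \<and> locally_integrable I g \<and>
     (\<forall>\<phi>. test_function I \<phi> \<longrightarrow>
        (LINT t|lebesgue_on I. f t * deriv \<phi> t) = - (LINT t|lebesgue_on I. g t * \<phi> t))"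

definition W1p :: "ereal \<Rightarrow> real set \<Rightarrow> (real \<Rightarrow> real) \<Rightarrow> bool" where
  "W1p p I f \<longleftrightarrow> Lp p I f \<and> (\<exists>g. Lp p I g \<and> has_weak_derivative I f g)"

section \<open>Sections of a monotone family\<close>

text \<open>
  A family of semi-norms is a function \<open>N\<close> with \<open>N t v\<close> the value of the \<open>t\<close>-th semi-norm at \<open>v\<close>;
  the space \<open>X\<^sub>t\<close> is \<open>ccompletion (N t)\<close>. Values of \<open>N\<close> and of sections outside the interval are
  irrelevant. Sections are representatives; all notions below are invariant under changing a
  section on a null set.
\<close>

definition monotone_family :: "ereal \<Rightarrow> (real \<Rightarrow> 'v::real_vector \<Rightarrow> real) \<Rightarrow> bool" where
  "monotone_family T N \<longleftrightarrow> (\<forall>t\<in>time_interval T. seminorm (N t)) \<and>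
     (\<forall>v. antimono_on (time_interval T) (\<lambda>t. N t v))"

definition is_section ::
  "ereal \<Rightarrow> (real \<Rightarrow> 'v::real_vector \<Rightarrow> real) \<Rightarrow> (real \<Rightarrow> (nat \<Rightarrow> 'v) set) \<Rightarrow> bool" where
  "is_section T N f \<longleftrightarrow> (\<forall>t\<in>time_interval T. f t \<in> ccompletion (N t))"

definition simple_section ::
  "ereal \<Rightarrow> (real \<Rightarrow> 'v::real_vector \<Rightarrow> real) \<Rightarrow> (real \<Rightarrow> (nat \<Rightarrow> 'v) set) \<Rightarrow> bool" where
  "simple_section T N f \<longleftrightarrow> (\<exists>(n::nat) A v.
     (\<forall>k<n. A k \<in> sets lebesgue \<and> A k \<subseteq> time_interval T) \<and>
     (\<forall>t\<in>time_interval T. f t = cembed (N t) (\<Sum>k<n. indicator (A k) t *\<^sub>R v k)))"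

definition measurable_section ::
  "ereal \<Rightarrow> (real \<Rightarrow> 'v::real_vector \<Rightarrow> real) \<Rightarrow> (real \<Rightarrow> (nat \<Rightarrow> 'v) set) \<Rightarrow> bool" where
  "measurable_section T N f \<longleftrightarrow> is_section T N f \<and>
     (\<exists>F. (\<forall>k::nat. simple_section T N (F k)) \<and>
        (AE t in lebesgue_on (time_interval T).
           (\<lambda>k. cnorm (N t) (cdiff (N t) (F k t) (f t))) \<longlonglongrightarrow> 0))"

definition Lp_section ::
  "ereal \<Rightarrow> ereal \<Rightarrow> (real \<Rightarrow> 'v::real_vector \<Rightarrow> real) \<Rightarrow> (real \<Rightarrow> (nat \<Rightarrow> 'v) set) \<Rightarrow> bool" where
  "Lp_section p T N f \<longleftrightarrow>
     measurable_section T N f \<and> Lp p (time_interval T) (\<lambda>t. cnorm (N t) (f t))"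

text \<open>
  ``For almost all \<open>s, t\<close>'' is read as: for all \<open>s, t\<close> outside a single null set.
\<close>

definition W1p_section ::
  "ereal \<Rightarrow> ereal \<Rightarrow> (real \<Rightarrow> 'v::real_vector \<Rightarrow> real) \<Rightarrow> (real \<Rightarrow> (nat \<Rightarrow> 'v) set) \<Rightarrow> bool" where
  "W1p_section p T N u \<longleftrightarrow> Lp_section p T N u \<and>
     (\<exists>g. Lp p (time_interval T) g \<and>
        (\<exists>E. E \<in> null_sets lebesgue \<and>
           (\<forall>s\<in>time_interval T - E. \<forall>t\<in>time_interval T - E. s \<le> t \<longrightarrow>
              cnorm (N t) (cdiff (N t) (u t) (ctransition (N s) (N t) (u s)))
                \<le> (LINT \<tau>|lebesgue_on {s..t}. g \<tau>))))"

end

theory Submission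
  imports Defs
begin

text \<open>
  A measurable section takes values, for almost every \<open>t\<close>, in the closure of one countable set
  \<open>C \<subseteq> V\<close>. For \<open>v \<in> C\<close> the weak derivative of \<open>\<psi>\<^sub>v\<close> is dominated by \<open>\<psi>'\<close>, hence
  \<open>\<bar>\<psi>\<^sub>v(t) - \<psi>\<^sub>v(s)\<bar> \<le> \<integral>\<^sub>s\<^sup>t \<psi>'\<close> for \<open>s \<le> t\<close> outside a null set, which can be chosen independent of
  \<open>v \<in> C\<close>. As \<open>P(s,t)\<close> is a contraction fixing \<open>v\<close>, the distance of \<open>u(t)\<close> and \<open>P(s,t)u(s)\<close> is at
  most \<open>\<psi>\<^sub>v(t) + \<psi>\<^sub>v(s) \<le> 2\<psi>\<^sub>v(s) + \<integral>\<^sub>s\<^sup>t \<psi>'\<close>, and \<open>\<psi>\<^sub>v(s)\<close> can be made arbitrarily small. So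
  \<open>g = \<psi>'\<close> works.
\<close>

section \<open>Measurable sections and the transition operators\<close>

text \<open>The value at \<open>t\<close> depends only on the set of indices \<open>k\<close> with
  \<open>t \<in> A k\<close>, so the finitely many subset sums of the \<open>v k\<close> exhaust the
  values, uniformly in \<open>t\<close>.\<close>

lemma simple_section_finite_values:
  assumes "simple_section T N f"
  obtains W where "finite W" "\<And>t. t \<in> time_interval T \<Longrightarrow> \<exists>v\<in>W. f t = cembed (N t) v"
proof -
  obtain n :: nat and A v where f: "\<And>t. t \<in> time_interval T \<Longrightarrow>
      f t = cembed (N t) (\<Sum>k<n. indicator (A k) t *\<^sub>R v k)"
    using assms unfolding simple_section_def by metis
  have "(\<Sum>k<n. indicator (A k) t *\<^sub>R v k) = (\<Sum>k\<in>{k\<in>{..<n}. t \<in> A k}. v k)" for t :: real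
    unfolding sum.inter_filter[OF finite_lessThan] by (intro sum.cong) (auto simp: indicator_def)
  then have "\<exists>w\<in>(\<lambda>B. \<Sum>k\<in>B. v k) ` Pow {..<n}. f t = cembed (N t) w" if "t \<in> time_interval T" for t
    using f[OF that] by auto
  then show thesis by (intro that[of "(\<lambda>B. \<Sum>k\<in>B. v k) ` Pow {..<n}"]) auto
qed

text \<open>The finite value sets of the approximating simple sections have a countable union.
  \<open>C\<close> does not depend on \<open>t\<close>, so null sets attached to its single vectors
  can later be united.\<close>

lemma measurable_section_separable:
  assumes N: "monotone_family T N" and f: "measurable_section T N f"
  obtains C where "countable C"
    "AE t in lebesgue_on (time_interval T). \<forall>e>0. \<exists>v\<in>C. cnorm (N t) (cdiff (N t) (f t) (cembed (N t) v)) < e"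
proof -
  obtain F where F: "\<And>k::nat. simple_section T N (F k)"
    and lim: "AE t in lebesgue_on (time_interval T). (\<lambda>k. cnorm (N t) (cdiff (N t) (F k t) (f t))) \<longlonglongrightarrow> 0"
    using f unfolding measurable_section_def by blast
  have "\<forall>k. \<exists>W. finite W \<and> (\<forall>t\<in>time_interval T. \<exists>v\<in>W. F k t = cembed (N t) v)"
    using simple_section_finite_values[OF F] by metis
  then obtain W where W: "\<And>k. finite (W k)"
    "\<And>k t. t \<in> time_interval T \<Longrightarrow> \<exists>v\<in>W k. F k t = cembed (N t) v"
    by metis
  show thesis
  proof (rule that[of "\<Union>k. W k"])
    show "countable (\<Union>k. W k)" using W(1) by (simp add: countable_finite)
    have close: "\<forall>e>0. \<exists>v\<in>\<Union>k. W k. cnorm (N t) (cdiff (N t) (f t) (cembed (N t) v)) < e"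
      if t: "t \<in> time_interval T" and l: "(\<lambda>k. cnorm (N t) (cdiff (N t) (F k t) (f t))) \<longlonglongrightarrow> 0" for t
    proof (intro allI impI)
      fix e :: real assume "e > 0"
      with order_tendstoD(2)[OF l] obtain k where k: "cnorm (N t) (cdiff (N t) (F k t) (f t)) < e"
        using eventually_happens by force
      obtain v where v: "v \<in> W k" "F k t = cembed (N t) v" using W(2)[OF t] by blast
      have sn: "seminorm (N t)" using N t by (simp add: monotone_family_def)
      have "f t \<in> ccompletion (N t)"
        using f t by (simp add: measurable_section_def is_section_def)
      then have "cnorm (N t) (cdiff (N t) (f t) (cembed (N t) v)) < e"
        using k v cnorm_cdiff_commute[OF sn _ cembed_in_ccompletion[OF sn]] by metis
      with v show "\<exists>v\<in>\<Union>k. W k. cnorm (N t) (cdiff (N t) (f t) (cembed (N t) v)) < e" by blast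
    qed
    show "AE t in lebesgue_on (time_interval T).
        \<forall>e>0. \<exists>v\<in>\<Union>k. W k. cnorm (N t) (cdiff (N t) (f t) (cembed (N t) v)) < e"
      using lim AE_space
    proof eventually_elim
      case (elim t)
      show ?case by (rule close) (use elim in auto)
    qed
  qed
qed

text \<open>A sequence representing \<open>x\<close> for \<open>p\<close> also represents its image
  for \<open>q\<close>, so the two norms are limits of \<open>p (a n - v)\<close> and
  \<open>q (a n - v)\<close>. The main estimate uses the transition operator only through these two
  facts.\<close>

lemma cnorm_ctransition_cembed_le:
  assumes p: "seminorm p" and q: "seminorm q" and le: "\<And>v. q v \<le> p v" and x: "x \<in> ccompletion p"
  shows "ctransition p q x \<in> ccompletion q"
    and "cnorm q (cdiff q (ctransition p q x) (cembed q v)) \<le> cnorm p (cdiff p x (cembed p v))"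
proof -
  obtain a where a: "a \<in> cauchy_seqs p" and xa: "x = cclass p a" using x by (rule ccompletionE)
  have aq: "a \<in> cauchy_seqs q" using cauchy_seqs_mono[of q p, OF le] a by blast
  have tr: "ctransition p q x = cclass q a" unfolding xa by (rule ctransition_cclass[OF p q le a])
  show "ctransition p q x \<in> ccompletion q" unfolding tr by (rule cclass_in_ccompletion[OF aq])
  have *: "(\<lambda>n. r (a n - v)) \<longlonglongrightarrow> cnorm r (cdiff r (cclass r a) (cembed r v))"
    if "seminorm r" "a \<in> cauchy_seqs r" for r
    using cnorm_cclass[OF that(1) cauchy_seqs_diff[OF that cauchy_seqs_const[OF that(1)]]]
    by (simp add: cembed_def cdiff_cclass[OF that cauchy_seqs_const[OF that(1)]])
  show "cnorm q (cdiff q (ctransition p q x) (cembed q v)) \<le> cnorm p (cdiff p x (cembed p v))"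
    unfolding tr unfolding xa using *[OF q aq] *[OF p a] by (rule LIMSEQ_le) (simp add: le)
qed

text \<open>Identifies the norm of a section with its distance to the vector 0, so that
  integrability of distance functions yields integrability of the norm.\<close>

lemma cnorm_eq_cdiff_zero:
  assumes p: "seminorm p" and x: "x \<in> ccompletion p"
  shows "cnorm p (cdiff p x (cembed p 0)) = cnorm p x"
proof -
  obtain a where a: "a \<in> cauchy_seqs p" and xa: "x = cclass p a" using x by (rule ccompletionE)
  show ?thesis
    unfolding xa cembed_def cdiff_cclass[OF p a cauchy_seqs_const[OF p]] by simp
qed

section \<open>Smooth cut-off functions\<close>

text \<open>
  A class of functions that is closed under differentiation, so that its members are smooth. The
  factor \<open>1 / x ^ k\<close> is present because differentiating \<open>exp (- 1 / x)\<close> produces such poles.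
\<close>

inductive smooth_alg :: "(real \<Rightarrow> real) \<Rightarrow> bool" where
  const: "smooth_alg (\<lambda>_. c)"
| exp_pole: "smooth_alg (\<lambda>x. if 0 < x then exp (- 1 / x) / x ^ k else 0)"
| affine: "smooth_alg f \<Longrightarrow> smooth_alg (\<lambda>x. f (a * x + b))"
| add: "smooth_alg f \<Longrightarrow> smooth_alg g \<Longrightarrow> smooth_alg (\<lambda>x. f x + g x)"
| mult: "smooth_alg f \<Longrightarrow> smooth_alg g \<Longrightarrow> smooth_alg (\<lambda>x. f x * g x)"
| inverse: "smooth_alg f \<Longrightarrow> (\<And>x. f x \<noteq> 0) \<Longrightarrow> smooth_alg (\<lambda>x. inverse (f x))"

text \<open>A single term of the exponential series bounds \<open>exp (1 / x)\<close> from below;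
  taking inverses shows that \<open>exp (- 1 / x)\<close> is flat to every order at 0.\<close>

lemma exp_minus_inverse_le_power:
  fixes x :: real
  assumes "0 < x"
  shows "exp (- 1 / x) \<le> fact n * x ^ n"
proof -
  have "(1 / x) ^ n / fact n \<le> exp (1 / x)"
  proof -
    have "(\<Sum>k\<in>{n}. (1 / x) ^ k /\<^sub>R fact k) \<le> (\<Sum>k. (1 / x) ^ k /\<^sub>R fact k)"
      by (rule sum_le_suminf[OF summable_exp_generic]) (use assms in auto)
    then show ?thesis by (simp add: exp_def field_simps)
  qed
  then have "inverse (exp (1 / x)) \<le> inverse ((1 / x) ^ n / fact n)"
    by (rule le_imp_inverse_le) (use assms in auto)
  then show ?thesis
    by (simp add: exp_minus field_simps)
qed

text \<open>The delicate point is 0, where flatness beats the pole. The derivative combines members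
  of the same family, with pole orders \<open>k + 2\<close> and \<open>k + 1\<close>.\<close>

lemma exp_pole_has_derivative:
  "((\<lambda>x. if 0 < x then exp (- 1 / x) / x ^ k else 0) has_real_derivative
    (if 0 < x then exp (- 1 / x) / x ^ (k + 2) else 0)
      + - real k * (if 0 < x then exp (- 1 / x) / x ^ (k + 1) else 0)) (at x)"
  (is "(?f has_real_derivative ?D) _")
proof -
  consider "x > 0" | "x < 0" | "x = 0" by linarith
  then show ?thesis
  proof cases
    case 1
    have "((\<lambda>x. exp (- 1 / x)) has_real_derivative exp (- 1 / x) / x ^ 2) (at x)"
      using 1 by (auto intro!: derivative_eq_intros simp: power2_eq_square)
    from DERIV_mult[OF this DERIV_inverse_fun[OF DERIV_pow[of k]]]
    \<comment> \<open>The split on \<open>k\<close> resolves the truncated exponent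
      \<open>k - Suc 0\<close> coming from \<open>DERIV_pow\<close>.\<close>
    have "((\<lambda>x. exp (- 1 / x) * inverse (x ^ k)) has_real_derivative ?D) (at x)"
      by (rule DERIV_cong) (use 1 in \<open>auto, cases k, auto simp: field_simps power2_eq_square\<close>)
    then show ?thesis
      by (rule has_field_derivative_transform_within_open[OF _ open_greaterThan[of 0]])
         (use 1 in \<open>auto simp: field_simps\<close>)
  next
    case 2
    show ?thesis
      by (rule has_field_derivative_transform_within_open[OF _ open_lessThan[of 0], of "\<lambda>_. 0"])
         (use 2 in auto)
  next
    case 3
    \<comment> \<open>Of the \<open>k + 2\<close> powers of \<open>h\<close>, \<open>k\<close>
      cancel the pole, one cancels the division by \<open>h\<close>, and one remains to force the
      difference quotient to 0.\<close>
    have bound: "\<bar>?f h / h\<bar> \<le> fact (k + 2) * \<bar>h\<bar>" for h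
    proof (cases "h > 0")
      case True
      have "exp (- 1 / h) / h ^ k \<le> fact (k + 2) * h ^ (k + 2) / h ^ k"
        by (rule divide_right_mono[OF exp_minus_inverse_le_power]) (use True in auto)
      also have "\<dots> = fact (k + 2) * h * h" using True by (simp add: power_add power2_eq_square)
      finally show ?thesis using True by (simp add: field_simps)
    next
      case False
      have "0 \<le> fact (k + 2) * \<bar>h\<bar>" by (intro mult_nonneg_nonneg) auto
      with False show ?thesis by auto
    qed
    have "((\<lambda>h. ?f h / h) \<longlongrightarrow> 0) (at 0)"
    proof (rule Lim_null_comparison)
      show "\<forall>\<^sub>F h in at 0. norm (?f h / h) \<le> fact (k + 2) * \<bar>h\<bar>"
        unfolding real_norm_def using bound by (intro always_eventually allI)
      show "((\<lambda>h. fact (k + 2) * \<bar>h\<bar>) \<longlongrightarrow> (0::real)) (at 0)"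
        by (rule tendsto_eq_intros refl | simp)+
    qed
    then show ?thesis using 3 by (simp add: DERIV_def cong: if_cong)
  qed
qed

text \<open>The rules of \<open>smooth_alg\<close> mirror the rules of calculus, so each case
  assembles its derivative from members. The witness \<open>f'\<close> carries differentiability
  along with membership, which allows iteration to all orders.\<close>

lemma smooth_alg_derivative:
  assumes "smooth_alg f"
  shows "\<exists>f'. smooth_alg f' \<and> (\<forall>x. (f has_real_derivative f' x) (at x))"
  using assms
proof induction
  case (const c)
  show ?case by (rule exI[of _ "\<lambda>_. 0"]) (auto intro: smooth_alg.const)
next
  case (exp_pole k)
  show ?case
    using exp_pole_has_derivative
      smooth_alg.add[OF smooth_alg.exp_pole smooth_alg.mult[OF smooth_alg.const smooth_alg.exp_pole]]
    by (intro exI conjI allI)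
next
  case (affine f a b)
  then obtain f' where f': "smooth_alg f'" "\<And>x. (f has_real_derivative f' x) (at x)" by blast
  have "((\<lambda>x. f (a * x + b)) has_real_derivative f' (a * x + b) * a) (at x)" for x
    by (rule DERIV_chain2[OF f'(2)]) (auto intro!: derivative_eq_intros)
  then show ?case
    using smooth_alg.mult[OF smooth_alg.affine[OF f'(1)] smooth_alg.const] by blast
next
  case (add f g)
  then obtain f' g' where "smooth_alg f'" "\<And>x. (f has_real_derivative f' x) (at x)"
    "smooth_alg g'" "\<And>x. (g has_real_derivative g' x) (at x)" by blast
  then show ?case
    by (intro exI[of _ "\<lambda>x. f' x + g' x"]) (auto intro: smooth_alg.add DERIV_add)
next
  case (mult f g)
  then obtain f' g' where d: "smooth_alg f'" "\<And>x. (f has_real_derivative f' x) (at x)"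
    "smooth_alg g'" "\<And>x. (g has_real_derivative g' x) (at x)" by blast
  show ?case
    by (rule exI[of _ "\<lambda>x. f' x * g x + g' x * f x"])
       (use mult.hyps d in \<open>auto intro: smooth_alg.add smooth_alg.mult DERIV_mult\<close>)
next
  case (inverse f)
  then obtain f' where f': "smooth_alg f'" "\<And>x. (f has_real_derivative f' x) (at x)" by blast
  have "((\<lambda>x. inverse (f x)) has_real_derivative (- 1) * (f' x * (inverse (f x) * inverse (f x)))) (at x)"
    for x
    by (rule DERIV_cong[OF DERIV_inverse_fun[OF f'(2) inverse.hyps(2)]]) (simp add: power2_eq_square)
  moreover have "smooth_alg (\<lambda>x. (- 1) * (f' x * (inverse (f x) * inverse (f x))))"
    by (intro smooth_alg.mult smooth_alg.const smooth_alg.inverse f' inverse.hyps)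
  ultimately show ?case by blast
qed

lemma smooth_alg_deriv:
  assumes "smooth_alg f"
  shows "smooth_alg (deriv f)"
proof -
  obtain f' where f': "smooth_alg f'" "\<And>x. (f has_real_derivative f' x) (at x)"
    using smooth_alg_derivative[OF assms] by blast
  then have "deriv f = f'" using DERIV_imp_deriv by blast
  with f' show ?thesis by simp
qed

lemma smooth_alg_differentiable: "smooth_alg f \<Longrightarrow> f differentiable (at x)"
  using smooth_alg_derivative real_differentiable_def by blast

lemma smooth_alg_iterated_deriv: "smooth_alg f \<Longrightarrow> smooth_alg ((deriv ^^ n) f)"
  by (induction n) (auto intro: smooth_alg_deriv)

lemma smooth_alg_continuous_on: "smooth_alg f \<Longrightarrow> continuous_on S f"
  by (meson smooth_alg_differentiable continuous_at_imp_continuous_on differentiable_imp_continuous_within)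

section \<open>Smooth approximate indicators and their antiderivatives\<close>

text \<open>The bump \<open>B\<close> is positive exactly on \<open>{0<..<h}\<close>. Hence
  \<open>B / (B + 1 / (n + 1))\<close> tends to 1 there and is 0 elsewhere, with convergence at
  every point.\<close>

lemma smooth_indicator_approximation:
  fixes h :: real
  obtains \<beta> :: "nat \<Rightarrow> real \<Rightarrow> real" where
    "\<And>n. smooth_alg (\<beta> n)" "\<And>n x. 0 \<le> \<beta> n x" "\<And>n x. \<beta> n x \<le> 1"
    "\<And>n x. x \<notin> {0<..<h} \<Longrightarrow> \<beta> n x = 0" "\<And>x. (\<lambda>n. \<beta> n x) \<longlonglongrightarrow> indicator {0<..<h} x"
proof -
  \<comment> \<open>The forms \<open>x ^ 0\<close> here and \<open>(- 1) * x + h\<close> in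
    \<open>B\<close> match the rules \<open>exp_pole\<close> and \<open>affine\<close>
    literally.\<close>
  define e :: "real \<Rightarrow> real" where "e x = (if 0 < x then exp (- 1 / x) / x ^ 0 else 0)" for x
  define B where "B x = e x * e ((- 1) * x + h)" for x
  define \<beta> where "\<beta> n x = B x * inverse (B x + inverse (real (Suc n)))" for n x
  have B0: "B x \<ge> 0" for x by (simp add: B_def e_def)
  have pos: "B x + inverse (real (Suc n)) > 0" for n x
    using B0[of x] by (intro add_nonneg_pos) auto
  have e: "smooth_alg e" unfolding e_def by (rule smooth_alg.exp_pole)
  have B: "smooth_alg B" unfolding B_def by (rule smooth_alg.mult[OF e smooth_alg.affine[OF e]])
  show thesis
  proof (rule that[of \<beta>])
    show "smooth_alg (\<beta> n)" for n
      unfolding \<beta>_def using pos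
      by (intro smooth_alg.mult smooth_alg.inverse smooth_alg.add smooth_alg.const B) (metis less_irrefl)
    show "0 \<le> \<beta> n x" for n x
      unfolding \<beta>_def using pos[of x n] B0[of x] by simp
    show "\<beta> n x \<le> 1" for n x
      unfolding \<beta>_def using pos[of x n] B0[of x] by (simp add: field_simps)
    show 0: "\<beta> n x = 0" if "x \<notin> {0<..<h}" for n x
      using that by (auto simp: \<beta>_def B_def e_def)
    show "(\<lambda>n. \<beta> n x) \<longlonglongrightarrow> indicator {0<..<h} x" for x
    proof (cases "x \<in> {0<..<h}")
      case True
      then have "B x > 0" by (auto simp: B_def e_def)
      then have "(\<lambda>n. \<beta> n x) \<longlonglongrightarrow> B x * inverse (B x + 0)"
        unfolding \<beta>_def
        by (intro tendsto_mult tendsto_inverse tendsto_add tendsto_const LIMSEQ_inverse_real_of_nat) auto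
      then show ?thesis using True \<open>B x > 0\<close> by simp
    qed (simp add: 0)
  qed
qed

text \<open>\<open>G\<close> is a smooth step; the difference of two translates will be the
  trapezoidal test function. The mean value theorem gives constancy beyond \<open>h\<close> and,
  from \<open>\<beta> \<le> 1\<close>, the height bound \<open>h\<close>.\<close>

lemma smooth_alg_antiderivative:
  assumes \<beta>: "smooth_alg \<beta>" "\<And>x. 0 \<le> \<beta> x" "\<And>x. \<beta> x \<le> 1" "\<And>x. x \<notin> {0<..<h} \<Longrightarrow> \<beta> x = 0"
    and h: "0 < h"
  obtains G where "\<And>x. (G has_real_derivative \<beta> x) (at x)" "mono G"
    "\<And>x. x \<le> 0 \<Longrightarrow> G x = 0" "\<And>x. x \<ge> h \<Longrightarrow> G x = G h" "\<And>x. G x \<le> h"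
proof -
  \<comment> \<open>The base point -1 keeps every \<open>x \<ge> 0\<close> in the interior of
    \<open>{-1..x + 1}\<close>, so the derivative there is two-sided; left of 0, \<open>G\<close>
    vanishes identically.\<close>
  define G where "G x = integral {-1..x} \<beta>" for x
  have G0: "G x = 0" if "x \<le> 0" for x
  proof -
    have "integral {-1..x} \<beta> = integral {-1..x} (\<lambda>_. 0)"
      using that \<beta>(4) by (intro integral_cong) auto
    then show ?thesis by (simp add: G_def)
  qed
  have der: "(G has_real_derivative \<beta> x) (at x)" for x
  proof (cases "x < 0")
    case True
    have "((\<lambda>_. 0) has_real_derivative \<beta> x) (at x)" using True \<beta>(4) by auto
    then show ?thesis
      by (rule has_field_derivative_transform_within_open[OF _ open_lessThan[of 0]])
         (use True G0 in auto)
  next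
    case False
    have "(G has_real_derivative \<beta> x) (at x within {-1..x + 1})"
      unfolding G_def using False
      by (intro integral_has_real_derivative smooth_alg_continuous_on \<beta>(1)) auto
    then show ?thesis
      using False at_within_interior[of x "{-1..x + 1}"] by (simp add: interior_atLeastAtMost_real)
  qed
  have mono: "mono G"
    by (rule monoI) (use der \<beta>(2) DERIV_nonneg_imp_nondecreasing in blast)
  have const: "G x = G h" if xh: "x \<ge> h" for x
  proof (cases "x = h")
    case False
    obtain z where "h < z" "z < x" "G x - G h = (x - h) * \<beta> z"
      using MVT2[of h x G \<beta>] der xh False by force
    then show ?thesis using \<beta>(4)[of z] by simp
  qed simp
  obtain z where "G h - G 0 = (h - 0) * \<beta> z"
    using MVT2[of 0 h G \<beta>] der h by force
  then have "G h \<le> h" using G0[of 0] \<beta>(3)[of z] h by (simp add: mult_left_le)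
  moreover have "G x \<le> G h" for x
    using const[of x] monoD[OF mono, of x h] by (cases "x \<ge> h") auto
  ultimately have "G x \<le> h" for x by (meson order_trans)
  then show thesis using that der mono G0 const by blast
qed

section \<open>Weak derivatives with an integrable majorant\<close>

text \<open>A trapezoid built from antiderivatives is not shown to lie in \<open>smooth_alg\<close>.
  Membership of its derivative is enough, since the higher derivatives are iterated derivatives of
  \<open>q\<close>.\<close>

lemma test_functionI:
  assumes q: "smooth_alg q" and der: "\<And>x. (\<phi> has_real_derivative q x) (at x)"
    and supp: "compact K" "K \<subseteq> I" "\<And>x. x \<notin> K \<Longrightarrow> \<phi> x = 0"
  shows "test_function I \<phi>"
proof -
  have dq: "deriv \<phi> = q" using der DERIV_imp_deriv by blast
  have "(deriv ^^ n) \<phi> differentiable (at t)" for n t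
  proof (cases n)
    case 0
    then show ?thesis using der real_differentiable_def by auto
  next
    case (Suc m)
    then have "(deriv ^^ n) \<phi> = (deriv ^^ m) q" by (simp add: funpow_Suc_right dq del: funpow.simps)
    then show ?thesis using smooth_alg_differentiable[OF smooth_alg_iterated_deriv[OF q]] by simp
  qed
  then show ?thesis using supp unfolding test_function_def by blast
qed

lemma integral_lebesgue_on_support:
  fixes f :: "real \<Rightarrow> real"
  assumes "J \<subseteq> I" "I \<in> sets lebesgue" "J \<in> sets lebesgue" "\<And>x. x \<notin> J \<Longrightarrow> f x = 0"
  shows "integral\<^sup>L (lebesgue_on I) f = integral\<^sup>L (lebesgue_on J) f"
proof -
  have "(\<lambda>x. indicator I x *\<^sub>R f x) = (\<lambda>x. indicator J x *\<^sub>R f x)"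
    using assms(1,4) by (auto simp: fun_eq_iff indicator_def)
  then show ?thesis using assms(2,3) by (simp add: integral_restrict_space)
qed

text \<open>
  Tests the weak derivative against smooth approximations of the trapezoid that rises on
  \<open>[s, s + h]\<close>, is constant in between and falls on \<open>[t, t + h]\<close>; the values lie in \<open>[0, h]\<close>, the
  derivatives converge to the difference of two indicators.
\<close>

lemma weak_derivative_average_diff_le:
  fixes s t h :: real
  assumes wd: "has_weak_derivative I f g" and I: "I \<in> sets lebesgue" and J: "{s..t + h} \<subseteq> I"
    and st: "s \<le> t" and h: "0 < h" and bound: "AE x in lebesgue_on I. \<bar>g x\<bar> \<le> \<psi> x"
    and \<psi>: "integrable (lebesgue_on {s..t + h}) \<psi>"
  shows "\<bar>integral {s..s + h} f - integral {t..t + h} f\<bar> \<le> h * (LINT x|lebesgue_on {s..t + h}. \<psi> x)"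
proof -
  define J where "J = {s..t + h}"
  have JI: "J \<subseteq> I" and Js: "J \<in> sets lebesgue" using J by (auto simp: J_def)
  have f: "integrable (lebesgue_on J) f" and g: "integrable (lebesgue_on J) g"
    using wd JI by (auto simp: has_weak_derivative_def locally_integrable_def J_def)
  note [measurable] = borel_measurable_integrable[OF f] borel_measurable_integrable[OF g]
  have bJ: "AE x in lebesgue_on J. \<bar>g x\<bar> \<le> \<psi> x"
    using bound JI I Js by (auto simp: AE_restrict_space_iff elim: AE_mp)
  obtain \<beta> :: "nat \<Rightarrow> real \<Rightarrow> real" where \<beta>: "\<And>n. smooth_alg (\<beta> n)" "\<And>n x. 0 \<le> \<beta> n x" "\<And>n x. \<beta> n x \<le> 1"
    "\<And>n x. x \<notin> {0<..<h} \<Longrightarrow> \<beta> n x = 0" "\<And>x. (\<lambda>n. \<beta> n x) \<longlonglongrightarrow> indicator {0<..<h} x"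
    using smooth_indicator_approximation by blast
  \<comment> \<open>The derivative of the smoothed trapezoid, written with
    \<open>1 * x + - s\<close> to fit the rule \<open>affine\<close>.\<close>
  define q where "q n x = \<beta> n (1 * x + - s) + (- 1) * \<beta> n (1 * x + - t)" for n x
  have q: "smooth_alg (q n)" for n
    unfolding q_def by (intro smooth_alg.add smooth_alg.mult smooth_alg.const smooth_alg.affine \<beta>)
  have q0: "q n x = 0" if "x \<notin> J" for n x
    using that st h by (auto simp: q_def J_def \<beta>(4))
  have q1: "\<bar>q n x\<bar> \<le> 1" for n x
    unfolding q_def using \<beta>(2)[of n "1 * x + - s"] \<beta>(2)[of n "1 * x + - t"]
      \<beta>(3)[of n "1 * x + - s"] \<beta>(3)[of n "1 * x + - t"] by linarith
  have [measurable]: "q n \<in> borel_measurable (lebesgue_on J)" for n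
    by (rule continuous_imp_measurable_on_sets_lebesgue[OF smooth_alg_continuous_on[OF q] Js])
  have bnd: "\<bar>LINT x|lebesgue_on J. f x * q n x\<bar> \<le> h * (LINT x|lebesgue_on J. \<psi> x)" for n
  proof -
    obtain G where G: "\<And>x. (G has_real_derivative \<beta> n x) (at x)" "mono G"
      "\<And>x. x \<le> 0 \<Longrightarrow> G x = 0" "\<And>x. x \<ge> h \<Longrightarrow> G x = G h" "\<And>x. G x \<le> h"
      using smooth_alg_antiderivative[OF \<beta>(1-4) h] by blast
    define \<phi> where "\<phi> x = G (1 * x + - s) - G (1 * x + - t)" for x
    have der: "(\<phi> has_real_derivative q n x) (at x)" for x
    proof -
      have "((\<lambda>x. G (1 * x + c)) has_real_derivative \<beta> n (1 * x + c) * 1) (at x)" for c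
        by (rule DERIV_chain2[OF G(1)]) (auto intro!: derivative_eq_intros)
      from DERIV_diff[OF this[of "- s"] this[of "- t"]] show ?thesis unfolding \<phi>_def q_def by simp
    qed
    \<comment> \<open>Left of \<open>J\<close> both translates of \<open>G\<close> are 0, right of
      \<open>J\<close> both equal \<open>G h\<close>; either way they cancel.\<close>
    have \<phi>0: "\<phi> x = 0" if "x \<notin> J" for x
      using that st h G(3) G(4)[of "x - s"] G(4)[of "x - t"] by (auto simp: \<phi>_def J_def not_le)
    have "0 \<le> G x" for x using G(3)[of "min 0 x"] monoD[OF G(2), of "min 0 x" x] by simp
    then have \<phi>1: "\<bar>\<phi> x\<bar> \<le> h" for x
      unfolding \<phi>_def using G(5)[of "1 * x + - s"] G(5)[of "1 * x + - t"]
      by (smt (verit))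
    have "continuous_on J \<phi>"
      using der by (meson DERIV_isCont continuous_at_imp_continuous_on)
    then have [measurable]: "\<phi> \<in> borel_measurable (lebesgue_on J)"
      using Js by (rule continuous_imp_measurable_on_sets_lebesgue)
    have "test_function I \<phi>"
      by (rule test_functionI[OF q der _ JI \<phi>0]) (simp add: J_def)
    moreover have "deriv \<phi> = q n" using der DERIV_imp_deriv by blast
    ultimately have "(LINT x|lebesgue_on I. f x * q n x) = - (LINT x|lebesgue_on I. g x * \<phi> x)"
      using wd unfolding has_weak_derivative_def by metis
    then have eq: "(LINT x|lebesgue_on J. f x * q n x) = - (LINT x|lebesgue_on J. g x * \<phi> x)"
      by (simp add: integral_lebesgue_on_support[OF JI I Js] q0 \<phi>0)
    have le: "AE x in lebesgue_on J. \<bar>g x * \<phi> x\<bar> \<le> h * \<psi> x"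
      using bJ
    proof eventually_elim
      case (elim x)
      have "\<bar>g x * \<phi> x\<bar> = \<bar>\<phi> x\<bar> * \<bar>g x\<bar>" by (simp add: abs_mult)
      also have "\<dots> \<le> h * \<psi> x" using elim \<phi>1[of x] h by (intro mult_mono) auto
      finally show ?case .
    qed
    have h\<psi>: "integrable (lebesgue_on J) (\<lambda>x. h * \<psi> x)" using \<psi> by (simp add: J_def)
    have "integrable (lebesgue_on J) (\<lambda>x. g x * \<phi> x)"
      by (rule Bochner_Integration.integrable_bound[OF h\<psi>]) (use le in \<open>auto elim: AE_mp\<close>)
    then have le': "(LINT x|lebesgue_on J. \<bar>g x * \<phi> x\<bar>) \<le> (LINT x|lebesgue_on J. h * \<psi> x)"
      by (intro integral_mono_AE h\<psi> le) auto
    show ?thesis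
      unfolding eq abs_minus_cancel using order_trans[OF integral_abs_bound le'] by simp
  qed
  \<comment> \<open>The limits of the \<open>\<beta> n\<close> are indicators of open intervals;
    adding the endpoints leaves the integral unchanged.\<close>
  have part: "integrable (lebesgue_on J) (\<lambda>x. f x * indicator {0<..<h} (x - c))"
    "(LINT x|lebesgue_on J. f x * indicator {0<..<h} (x - c)) = integral {c..c + h} f"
    if "{c..c + h} \<subseteq> J" for c
  proof -
    have A: "{c<..<c + h} \<subseteq> J" "{c<..<c + h} \<in> sets lebesgue" using that by force+
    have ind: "f x * indicator {0<..<h} (x - c) = indicator {c<..<c + h} x *\<^sub>R f x" for x
      by (auto simp: indicator_def)
    have sJ: "{c<..<c + h} \<in> sets (lebesgue_on J)" using A Js by (auto simp: sets_restrict_space)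
    show int: "integrable (lebesgue_on J) (\<lambda>x. f x * indicator {0<..<h} (x - c))"
      unfolding ind by (rule integrable_mult_indicator[OF sJ f])
    have "(LINT x|lebesgue_on J. f x * indicator {0<..<h} (x - c))
        = (LINT x|lebesgue_on {c<..<c + h}. f x * indicator {0<..<h} (x - c))"
      by (rule integral_lebesgue_on_support[OF A(1) Js A(2)]) (auto simp: indicator_def)
    also have "\<dots> = (LINT x|lebesgue_on {c<..<c + h}. f x)"
      by (intro Bochner_Integration.integral_cong) auto
    also have "\<dots> = integral {c<..<c + h} f"
    proof (rule lebesgue_integral_eq_integral[OF _ A(2)])
      show "integrable (lebesgue_on {c<..<c + h}) f"
        using int JI A f Js unfolding ind
        by (simp add: integrable_restrict_space indicator_inter_arith[symmetric] Int_absorb1 Int_absorb2 mult.assoc[symmetric])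
    qed
    finally show "(LINT x|lebesgue_on J. f x * indicator {0<..<h} (x - c)) = integral {c..c + h} f"
      by (simp add: integral_open_interval_real)
  qed
  have sub: "{s..s + h} \<subseteq> J" "{t..t + h} \<subseteq> J" using st by (auto simp: J_def)
  \<comment> \<open>Dominated convergence: since \<open>q n\<close> is bounded by 1 in absolute
    value, \<open>f\<close> itself provides the dominating function.\<close>
  have "(\<lambda>n. LINT x|lebesgue_on J. f x * q n x) \<longlonglongrightarrow>
      (LINT x|lebesgue_on J. f x * indicator {0<..<h} (x - s) - f x * indicator {0<..<h} (x - t))"
  proof (rule integral_dominated_convergence[where w = "\<lambda>x. \<bar>f x\<bar>"])
    show "(\<lambda>x. f x * indicator {0<..<h} (x - s) - f x * indicator {0<..<h} (x - t))
        \<in> borel_measurable (lebesgue_on J)"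
      by (intro borel_measurable_diff borel_measurable_integrable part sub)
    show "AE x in lebesgue_on J. (\<lambda>n. f x * q n x) \<longlonglongrightarrow>
        f x * indicator {0<..<h} (x - s) - f x * indicator {0<..<h} (x - t)"
    proof (rule AE_I2)
      fix x
      have "(\<lambda>n. f x * q n x) \<longlonglongrightarrow>
          f x * (indicator {0<..<h} (1 * x + - s) + (- 1) * indicator {0<..<h} (1 * x + - t))"
        unfolding q_def by (intro tendsto_intros \<beta>(5))
      then show "(\<lambda>n. f x * q n x) \<longlonglongrightarrow>
          f x * indicator {0<..<h} (x - s) - f x * indicator {0<..<h} (x - t)"
        by (simp add: algebra_simps)
    qed
    show "AE x in lebesgue_on J. norm (f x * q n x) \<le> \<bar>f x\<bar>" for n
      using q1[of n] by (intro AE_I2) (simp add: abs_mult mult_left_le)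
  qed (use f in auto)
  also have "(LINT x|lebesgue_on J. f x * indicator {0<..<h} (x - s) - f x * indicator {0<..<h} (x - t))
      = integral {s..s + h} f - integral {t..t + h} f"
    by (subst Bochner_Integration.integral_diff) (use part sub in auto)
  finally have "(\<lambda>n. \<bar>LINT x|lebesgue_on J. f x * q n x\<bar>) \<longlonglongrightarrow> \<bar>integral {s..s + h} f - integral {t..t + h} f\<bar>"
    by (rule tendsto_rabs)
  then show ?thesis
    by (rule LIMSEQ_le_const2) (use bnd in \<open>auto simp: J_def\<close>)
qed

section \<open>Local integrability, Lebesgue points and increments\<close>

text \<open>Compact sets have finite measure, so essential boundedness, or the pointwise bound of
  the modulus by 1 plus its \<open>r\<close>-th power, suffices. This makes the majorant integrable
  over each \<open>{s..t}\<close> inside the interval.\<close>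

lemma locally_integrable_Lp:
  assumes f: "Lp p I f" and p: "1 \<le> p" and I: "I \<in> sets lebesgue"
  shows "locally_integrable I f"
  unfolding locally_integrable_def
proof (intro allI impI)
  fix K assume K: "compact K" "K \<subseteq> I"
  then have Ks: "K \<in> sets lebesgue" by (simp add: compact_imp_closed borel_closed)
  interpret finite_measure "lebesgue_on K"
    by (rule finite_measure_lebesgue_on) (simp add: K lmeasurable_compact)
  have fK: "f \<in> borel_measurable (lebesgue_on K)"
    using f K(2) unfolding Lp_def by (blast intro: measurable_restrict_mono)
  have AE_K: "AE x in lebesgue_on K. P x" if "AE x in lebesgue_on I. P x" for P
    using that K(2) I Ks by (auto simp: AE_restrict_space_iff elim: AE_mp)
  show "integrable (lebesgue_on K) f"
  proof (cases "p = \<infinity>")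
    case True
    then obtain C where "AE t in lebesgue_on I. \<bar>f t\<bar> \<le> C" using f by (auto simp: Lp_def)
    from AE_K[OF this] show ?thesis
      by (intro integrable_const_bound[of _ C] fK) auto
  next
    case False
    define r where "r = real_of_ereal p"
    have r: "1 \<le> r" using p False unfolding r_def by (cases p) auto
    have "integrable (lebesgue_on I) (\<lambda>t. \<bar>f t\<bar> powr r)"
      using f False by (simp add: Lp_def r_def)
    then have "integrable lebesgue (\<lambda>t. indicator I t *\<^sub>R (\<bar>f t\<bar> powr r))"
      using I by (simp add: integrable_restrict_space)
    from integrable_mult_indicator[OF Ks this]
    have "integrable lebesgue (\<lambda>t. indicator K t *\<^sub>R (\<bar>f t\<bar> powr r))"
      by (rule Bochner_Integration.integrable_cong[THEN iffD1, rotated -1])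
         (use K(2) in \<open>auto simp: indicator_def\<close>)
    then have "integrable (lebesgue_on K) (\<lambda>t. \<bar>f t\<bar> powr r)"
      using Ks by (simp add: integrable_restrict_space)
    then have int: "integrable (lebesgue_on K) (\<lambda>t. 1 + \<bar>f t\<bar> powr r)" by simp
    have "\<bar>f t\<bar> \<le> 1 + \<bar>f t\<bar> powr r" for t
    proof (cases "\<bar>f t\<bar> \<le> 1")
      case False
      then show ?thesis using powr_mono[OF r, of "\<bar>f t\<bar>"] by simp
    qed (simp add: add_increasing2)
    then show ?thesis
      by (intro Bochner_Integration.integrable_bound[OF int fK]) (simp add: add_nonneg_nonneg)
  qed
qed

text \<open>As \<open>f\<close> need not be integrable on all of \<open>I\<close>, differentiation
  of integrals is applied on closed intervals with rational endpoints inside \<open>I\<close>. These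
  are countably many and their interiors cover \<open>I\<close>.\<close>

lemma locally_integrable_Lebesgue_points:
  fixes f :: "real \<Rightarrow> real"
  assumes I: "open I" and f: "locally_integrable I f"
  obtains E where "E \<in> null_sets lebesgue"
    "\<And>x. x \<in> I - E \<Longrightarrow> ((\<lambda>h. integral {x..x + h} f / h) \<longlongrightarrow> f x) (at_right 0)"
proof -
  define J where "J = {(a, b). a \<in> \<rat> \<and> b \<in> \<rat> \<and> {a..b} \<subseteq> I}"
  have "\<exists>E. negligible E \<and> (\<forall>x\<in>{a<..<b} - E. ((\<lambda>h. integral {x..x + h} f / h) \<longlongrightarrow> f x) (at_right 0))"
    if ab: "(a, b) \<in> J" for a b
  proof -
    \<comment> \<open>Extension by zero, because \<open>integrable_ccontinuous_explicit\<close> asks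
      for integrability on every box.\<close>
    define F where "F x = (if x \<in> {a..b} then f x else 0)" for x
    have "integrable (lebesgue_on {a..b}) f"
      using f ab by (auto simp: locally_integrable_def J_def)
    then have "f integrable_on {a..b}" by (simp add: integrable_on_lebesgue_on)
    then have "F integrable_on UNIV" unfolding F_def by (simp only: integrable_restrict_UNIV)
    then have "F integrable_on cbox c d" for c d by (rule integrable_on_subcbox) simp
    then obtain E where E: "negligible E" "\<And>x e. x \<notin> E \<Longrightarrow> 0 < e \<Longrightarrow>
        \<exists>d>0. \<forall>h. 0 < h \<and> h < d \<longrightarrow> norm (integral (cbox x (x + h *\<^sub>R One)) F /\<^sub>R h ^ DIM(real) - F x) < e"
      by (rule integrable_ccontinuous_explicit) auto
    have "((\<lambda>h. integral {x..x + h} f / h) \<longlongrightarrow> f x) (at_right 0)" if x: "x \<in> {a<..<b} - E" for x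
      unfolding tendsto_iff
    proof (intro allI impI)
      fix e :: real assume "e > 0"
      then obtain d where d: "d > 0"
        "\<And>h. 0 < h \<Longrightarrow> h < d \<Longrightarrow> norm (integral (cbox x (x + h *\<^sub>R One)) F /\<^sub>R h ^ DIM(real) - F x) < e"
        using E(2)[of x e] x by auto
      \<comment> \<open>The bound \<open>h < b - x\<close> keeps \<open>{x..x + h}\<close> inside
        \<open>{a..b}\<close>, where \<open>F\<close> and \<open>f\<close> agree.\<close>
      have "dist (integral {x..x + h} f / h) (f x) < e" if h: "0 < h" "h < min d (b - x)" for h
      proof -
        have "integral {x..x + h} F = integral {x..x + h} f"
          using x h by (intro Henstock_Kurzweil_Integration.integral_cong) (auto simp: F_def)
        moreover have "F x = f x" using x by (simp add: F_def)
        ultimately show ?thesis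
          using d(2)[of h] h by (simp add: dist_real_def divide_inverse_commute)
      qed
      then show "\<forall>\<^sub>F h in at_right 0. dist (integral {x..x + h} f / h) (f x) < e"
        unfolding eventually_at_right_field using d(1) x by (intro exI[of _ "min d (b - x)"]) auto
    qed
    with E(1) show ?thesis by blast
  qed
  then have "\<forall>z\<in>J. \<exists>E. negligible E \<and>
      (\<forall>x\<in>{fst z<..<snd z} - E. ((\<lambda>h. integral {x..x + h} f / h) \<longlongrightarrow> f x) (at_right 0))"
    by auto
  from bchoice[OF this] obtain E where E: "\<And>z. z \<in> J \<Longrightarrow> negligible (E z)"
    "\<And>z x. z \<in> J \<Longrightarrow> x \<in> {fst z<..<snd z} - E z \<Longrightarrow>
      ((\<lambda>h. integral {x..x + h} f / h) \<longlongrightarrow> f x) (at_right 0)"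
    by blast
  show thesis
  proof (rule that[of "\<Union>z\<in>J. E z"])
    have "J \<subseteq> \<rat> \<times> \<rat>" by (auto simp: J_def)
    then have "countable J" by (rule countable_subset) (simp add: countable_rat)
    then show "(\<Union>z\<in>J. E z) \<in> null_sets lebesgue"
      by (intro null_sets_UN') (auto simp: E(1) negligible_iff_null_sets[symmetric])
    fix x assume x: "x \<in> I - (\<Union>z\<in>J. E z)"
    with I obtain e where e: "e > 0" "cball x e \<subseteq> I" by (auto simp: open_contains_cball)
    obtain a b where ab: "a \<in> \<rat>" "x - e < a" "a < x" "b \<in> \<rat>" "x < b" "b < x + e"
      using Rats_dense_in_real[of "x - e" x] Rats_dense_in_real[of x "x + e"] e(1) by auto
    then have "{a..b} \<subseteq> cball x e" by (auto simp: dist_real_def)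
    with ab e(2) have "(a, b) \<in> J" by (auto simp: J_def)
    then show "((\<lambda>h. integral {x..x + h} f / h) \<longlongrightarrow> f x) (at_right 0)"
      using x ab by (intro E(2)[of "(a, b)"]) auto
  qed
qed

text \<open>Divide the averaged estimate by \<open>h\<close> and let \<open>h\<close> decrease to 0
  at Lebesgue points of \<open>f\<close>. \<open>E\<close> collects the exceptional points of
  \<open>f\<close> alone, hence serves all pairs \<open>s\<close>, \<open>t\<close> at once.\<close>

lemma weak_derivative_increment_le:
  assumes I: "open I" "is_interval I" and wd: "has_weak_derivative I f g"
    and bound: "AE x in lebesgue_on I. \<bar>g x\<bar> \<le> \<psi> x" and \<psi>: "locally_integrable I \<psi>"
  obtains E where "E \<in> null_sets lebesgue"
    "\<And>s t. s \<in> I - E \<Longrightarrow> t \<in> I - E \<Longrightarrow> s \<le> t \<Longrightarrow> \<bar>f s - f t\<bar> \<le> (LINT x|lebesgue_on {s..t}. \<psi> x)"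
proof -
  have "locally_integrable I f" using wd by (simp add: has_weak_derivative_def)
  from locally_integrable_Lebesgue_points[OF I(1) this] obtain E where E: "E \<in> null_sets lebesgue"
    "\<And>x. x \<in> I - E \<Longrightarrow> ((\<lambda>h. integral {x..x + h} f / h) \<longlongrightarrow> f x) (at_right 0)" by blast
  have "\<bar>f s - f t\<bar> \<le> (LINT x|lebesgue_on {s..t}. \<psi> x)"
    if s: "s \<in> I - E" and t: "t \<in> I - E" and st: "s \<le> t" for s t
  proof -
    \<comment> \<open>Openness gives room to the right of \<open>t\<close>; the interval property
      then keeps \<open>{s..t + h}\<close> inside \<open>I\<close> for all
      \<open>h < e\<close>.\<close>
    obtain e where e: "e > 0" "cball t e \<subseteq> I" using I(1) t by (auto simp: open_contains_cball)
    have "t + e \<in> I" using e by (auto simp: dist_real_def)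
    then have sub: "{s..t + e} \<subseteq> I"
      using s mem_is_interval_1_I[OF I(2), of s "t + e"] by auto
    have int: "integrable (lebesgue_on {s..t + e}) \<psi>"
      using \<psi> sub by (simp add: locally_integrable_def)
    \<comment> \<open>Continuity of the integral in its upper limit, restricted to the right of
      \<open>t\<close> because the averages are right-sided.\<close>
    have "((\<lambda>y. LINT x|lebesgue_on {s..y}. \<psi> x) \<longlongrightarrow> (LINT x|lebesgue_on {s..t}. \<psi> x)) (at t within {s..t + e})"
      using indefinite_integral_continuous_real[OF int] st e(1) by (auto simp: continuous_on_def)
    then have "((\<lambda>y. LINT x|lebesgue_on {s..y}. \<psi> x) \<longlongrightarrow> (LINT x|lebesgue_on {s..t}. \<psi> x)) (at t within {t..t + e})"
      by (rule tendsto_within_subset) (use st in auto)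
    then have "((\<lambda>y. LINT x|lebesgue_on {s..y}. \<psi> x) \<longlongrightarrow> (LINT x|lebesgue_on {s..t}. \<psi> x)) (at_right t)"
      using e(1) by (simp add: at_within_Icc_at_right)
    then have lim\<psi>: "((\<lambda>h. LINT x|lebesgue_on {s..t + h}. \<psi> x) \<longlongrightarrow> (LINT x|lebesgue_on {s..t}. \<psi> x)) (at_right 0)"
      by (simp add: filterlim_at_right_to_0[of _ _ t] add.commute)
    have limf: "((\<lambda>h. \<bar>integral {s..s + h} f / h - integral {t..t + h} f / h\<bar>) \<longlongrightarrow> \<bar>f s - f t\<bar>) (at_right 0)"
      by (intro tendsto_intros E(2) s t)
    have "\<forall>\<^sub>F h in at_right 0. \<bar>integral {s..s + h} f / h - integral {t..t + h} f / h\<bar>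
        \<le> (LINT x|lebesgue_on {s..t + h}. \<psi> x)"
      unfolding eventually_at_right_field
    proof (intro exI[of _ e] conjI allI impI e(1))
      fix h :: real assume h: "0 < h" "h < e"
      have hI: "{s..t + h} \<subseteq> {s..t + e}" using h by auto
      have "\<bar>integral {s..s + h} f - integral {t..t + h} f\<bar> \<le> h * (LINT x|lebesgue_on {s..t + h}. \<psi> x)"
        by (rule weak_derivative_average_diff_le[OF wd _ order_trans[OF hI sub] st h(1) bound])
           (use I(1) Equivalence_Lebesgue_Henstock_Integration.integrable_subinterval[OF int hI] in auto)
      moreover have "\<bar>integral {s..s + h} f / h - integral {t..t + h} f / h\<bar>
          = \<bar>integral {s..s + h} f - integral {t..t + h} f\<bar> / h"
        using h(1) by (simp flip: diff_divide_distrib)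
      ultimately show "\<bar>integral {s..s + h} f / h - integral {t..t + h} f / h\<bar>
          \<le> (LINT x|lebesgue_on {s..t + h}. \<psi> x)"
        using h(1) by (simp add: pos_divide_le_eq mult.commute)
    qed
    then show ?thesis
      by (rule tendsto_le[OF _ lim\<psi> limf, rotated]) simp
  qed
  with E(1) that show thesis by blast
qed

section \<open>The time interval, and invariance of integrability classes\<close>

lemma open_time_interval: "open (time_interval T)"
proof -
  have "time_interval T = {0<..} \<inter> ereal -` {..<T}" by (auto simp: time_interval_def)
  then show ?thesis by (simp add: open_Int open_ereal_vimage)
qed

lemma is_interval_time_interval: "is_interval (time_interval T)"
  unfolding is_interval_1
proof (intro ballI allI impI)
  fix a b x :: real
  assume ab: "a \<in> time_interval T" "b \<in> time_interval T" and x: "a \<le> x \<and> x \<le> b"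
  have "ereal x \<le> ereal b" using x by simp
  also have "\<dots> < T" using ab(2) by (simp add: time_interval_def)
  finally show "x \<in> time_interval T" using ab(1) x by (simp add: time_interval_def)
qed

lemma Lp_cong:
  assumes "\<And>t. t \<in> I \<Longrightarrow> f t = g t"
  shows "Lp p I f \<longleftrightarrow> Lp p I g"
proof -
  have "f \<in> borel_measurable (lebesgue_on I) \<longleftrightarrow> g \<in> borel_measurable (lebesgue_on I)"
    using assms by (intro measurable_cong) simp
  moreover have "(AE t in lebesgue_on I. \<bar>f t\<bar> \<le> C) \<longleftrightarrow> (AE t in lebesgue_on I. \<bar>g t\<bar> \<le> C)" for C
    using assms by (intro AE_cong) simp
  moreover have "integrable (lebesgue_on I) (\<lambda>t. \<bar>f t\<bar> powr real_of_ereal p)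
      \<longleftrightarrow> integrable (lebesgue_on I) (\<lambda>t. \<bar>g t\<bar> powr real_of_ereal p)"
    using assms by (intro Bochner_Integration.integrable_cong) auto
  ultimately show ?thesis by (simp add: Lp_def)
qed

section \<open>The Sobolev space of sections\<close>

theorem theorem6p3:
  fixes p T :: ereal
    and N :: "real \<Rightarrow> 'v::real_vector \<Rightarrow> real"
    and u :: "real \<Rightarrow> (nat \<Rightarrow> 'v) set"
    and \<psi> D :: "'v \<Rightarrow> real \<Rightarrow> real"
    and \<psi>' :: "real \<Rightarrow> real"
  assumes p: "1 \<le> p" and T: "0 < T"
    and N: "monotone_family T N"
    and u: "measurable_section T N u"
    and \<psi>: "\<And>v t. \<psi> v t = cnorm (N t) (cdiff (N t) (u t) (cembed (N t) v))"
    and A: "\<And>v. W1p p (time_interval T) (\<psi> v)"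
    and D: "\<And>v. has_weak_derivative (time_interval T) (\<psi> v) (D v)"
    and \<psi>': "Lp p (time_interval T) \<psi>'"
    and B: "\<And>v. AE t in lebesgue_on (time_interval T). \<bar>D v t\<bar> \<le> \<psi>' t"
  shows "W1p_section p T N u"
proof -
  let ?I = "time_interval T"
  have I: "?I \<in> sets lebesgue" by (simp add: borel_open open_time_interval)
  have sn: "seminorm (N t)" if "t \<in> ?I" for t using N that by (simp add: monotone_family_def)
  have uc: "u t \<in> ccompletion (N t)" if "t \<in> ?I" for t
    using u that by (simp add: measurable_section_def is_section_def)
  \<comment> \<open>The vector 0 in \<open>A\<close> gives the integrability of the norm of
    \<open>u\<close>.\<close>
  have "Lp p ?I (\<psi> 0)" using A by (simp add: W1p_def)
  moreover have "\<psi> 0 t = cnorm (N t) (u t)" if "t \<in> ?I" for t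
    unfolding \<psi> by (rule cnorm_eq_cdiff_zero[OF sn[OF that] uc[OF that]])
  ultimately have "Lp p ?I (\<lambda>t. cnorm (N t) (u t))"
    using Lp_cong[of ?I "\<psi> 0" "\<lambda>t. cnorm (N t) (u t)" p] by blast
  with u have Lp_u: "Lp_section p T N u" by (simp add: Lp_section_def)
  obtain C where C: "countable C"
    and AE_C: "AE t in lebesgue_on ?I. \<forall>e>0. \<exists>v\<in>C. cnorm (N t) (cdiff (N t) (u t) (cembed (N t) v)) < e"
    using measurable_section_separable[OF N u] by blast
  from AE_E3[OF AE_C] obtain E0 where "E0 \<in> null_sets (lebesgue_on ?I)"
    and dense: "\<And>t. t \<in> ?I - E0 \<Longrightarrow> \<forall>e>0. \<exists>v\<in>C. \<psi> v t < e"
    unfolding \<psi> by (metis space_lebesgue_on)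
  then have E0: "E0 \<in> null_sets lebesgue" by (simp add: null_sets_restrict_space[OF I])
  have "\<exists>E\<in>null_sets lebesgue. \<forall>s\<in>?I - E. \<forall>t\<in>?I - E. s \<le> t \<longrightarrow>
      \<bar>\<psi> v s - \<psi> v t\<bar> \<le> (LINT x|lebesgue_on {s..t}. \<psi>' x)" for v
    using weak_derivative_increment_le[OF open_time_interval is_interval_time_interval D B
        locally_integrable_Lp[OF \<psi>' p I], of v] by metis
  then obtain E where E: "\<And>v. E v \<in> null_sets lebesgue"
    "\<And>v s t. s \<in> ?I - E v \<Longrightarrow> t \<in> ?I - E v \<Longrightarrow> s \<le> t \<Longrightarrow>
      \<bar>\<psi> v s - \<psi> v t\<bar> \<le> (LINT x|lebesgue_on {s..t}. \<psi>' x)"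
    by metis
  \<comment> \<open>The null set \<open>E v\<close> varies with \<open>v\<close>; restricting to the
    countable \<open>C\<close> keeps the union null.\<close>
  define Z where "Z = E0 \<union> (\<Union>v\<in>C. E v)"
  have Z: "Z \<in> null_sets lebesgue"
    unfolding Z_def using C E0 E(1) by (intro null_sets.Un null_sets_UN') auto
  have "cnorm (N t) (cdiff (N t) (u t) (ctransition (N s) (N t) (u s))) \<le> (LINT x|lebesgue_on {s..t}. \<psi>' x)"
    if s: "s \<in> ?I - Z" and t: "t \<in> ?I - Z" and st: "s \<le> t" for s t
  \<comment> \<open>The vector \<open>v\<close> close to \<open>u s\<close> depends on
    \<open>s\<close> and \<open>e\<close>, but its exceptional set already lies in
    \<open>Z\<close>.\<close>
  proof (rule field_le_epsilon)
    fix e :: real assume "e > 0"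
    then obtain v where v: "v \<in> C" "\<psi> v s < e / 2"
      using dense[of s] s half_gt_zero[of e] unfolding Z_def by blast
    have sI: "s \<in> ?I" and tI: "t \<in> ?I" using s t by auto
    have le: "N t w \<le> N s w" for w
      using N sI tI st by (auto simp: monotone_family_def monotone_on_def)
    let ?P = "ctransition (N s) (N t) (u s)"
    note tr = cnorm_ctransition_cembed_le[OF sn[OF sI] sn[OF tI] le uc[OF sI]]
    note emb = cembed_in_ccompletion[OF sn[OF tI]]
    have "cnorm (N t) (cdiff (N t) (u t) ?P)
        \<le> \<psi> v t + cnorm (N t) (cdiff (N t) (cembed (N t) v) ?P)"
      unfolding \<psi> by (rule cnorm_cdiff_triangle[OF sn[OF tI] uc[OF tI] emb tr(1)])
    also have "\<dots> \<le> \<psi> v t + \<psi> v s"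
      unfolding \<psi> using tr(2) cnorm_cdiff_commute[OF sn[OF tI] emb tr(1)] by simp
    \<comment> \<open>The increment bound replaces \<open>\<psi> v t\<close> by
      \<open>\<psi> v s\<close> plus the integral, and two copies of
      \<open>\<psi> v s < e / 2\<close> make up \<open>e\<close>.\<close>
    also have "\<dots> \<le> (LINT x|lebesgue_on {s..t}. \<psi>' x) + e"
      using E(2)[of s v t] s t st v by (auto simp: Z_def)
    finally show "cnorm (N t) (cdiff (N t) (u t) ?P) \<le> (LINT x|lebesgue_on {s..t}. \<psi>' x) + e" .
  qed
  with Z \<psi>' Lp_u show ?thesis unfolding W1p_section_def by blast
qed

end
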